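(* Let $T$ be a propositional theory over $\mathcal V$, let $(\mathcal A,\oplus,\otimes,e^\oplus,e^\otimes)$ be a commutative semiring, and let $\alpha:\mathcal L\to\mathcal A$ be a labeling function on the literals of $\mathcal V$. Assume that $\otimes$ is idempotent ($a\otimes a=a$ for all $a\in\mathcal A$) and that $(\otimes,\alpha)$ is consistency-preserving, i.e. $\alpha(v)\otimes\alpha(\neg v)=e^\oplus$ for all $v\in\mathcal V$. If $N_T$ is an sd-NNF representation of $T$ (i.e. an NNF circuit that is smooth and deterministic, is logically equivalent to $T$, and whose set of variables is $\mathcal V$), then evaluating $N_T$ is a sound AMC computation, i.e. $$\mathrm{Eval}(N_T,\oplus,\otimes,e^\oplus,e^\otimes,\alpha)=\mathbf A(T).$$
   Context: A semiring $(\mathcal A,\oplus,\otimes,e^\oplus,e^\otimes)$ has associative binary operations $\oplus,\otimes$ on $\mathcal A$, with $\oplus$ commutative, $\otimes$ distributing over $\oplus$, $e^\oplus$ neutral for $\oplus$, $e^\otimes$ neutral for $\otimes$, and $e^\oplus\otimes a=a\otimes e^\oplus=e^\oplus$ for all $a$. It is commutative if $\otimes$ is also commutative. Algebraic model count: for a propositional theory $T$ over a finite set $\mathcal V$ of variables and $\alpha:\mathcal L\to\mathcal A$ on the set $\mathcal L$ of literals of $\mathcal V$, $$\mathbf A(T)=\bigoplus_{I\in\mathcal M(T)}\ \bigotimes_{l\in I}\alpha(l),$$ where $\mathcal M(T)$ is the set of models of $T$; a model is a set of literals containing exactly one of $v,\neg v$ for each $v\in\mathcal V$. Empty sums are $e^\oplus$,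 empty products $e^\otimes$. An NNF circuit over $\mathcal V$ is a finite rooted directed acyclic graph whose leaves are labeled with $\top$, $\bot$ or a literal of a variable in $\mathcal V$, and whose internal nodes are labeled $\vee$ or $\wedge$. Each node is identified with the formula of the subcircuit rooted at it, and its variables are those occurring in that subcircuit. The circuit is deterministic if for each disjunction node $\bigvee_{i=1}^n\phi_i$ each two children $\phi_i,\phi_j$ ($i\ne j$) are logically inconsistent; smooth if for each disjunction node all children mention the same set of variables. $\mathrm{Eval}$ is defined recursively from the leaves to the root: $\top\mapsto e^\otimes$, $\bot\mapsto e^\oplus$, literal $l\mapsto\alpha(l)$, a disjunction node $\mapsto$ the $\oplus$-sum of the values of its children, a conjunction node $\mapsto$ the $\otimes$-product of the values of its children; the value of the circuit is that of its root. *)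

theory Defs
  imports Main "HOL-Library.Multiset"
begin

datatype 'v literal = Pos 'v | Neg 'v

datatype (fvars: 'v) formula =
    FTrue
  | FFalse
  | FVar 'v
  | FNot "'v formula"
  | FAnd "'v formula multiset"
  | FOr "'v formula multiset"

definition literals :: "'v set \<Rightarrow> 'v literal set" where
  "literals V = Pos ` V \<union> Neg ` V"

definition interpretations :: "'v set \<Rightarrow> 'v literal set set" where
  "interpretations V = {I. I \<subseteq> literals V \<and> (\<forall>v\<in>V. (Pos v \<in> I) \<noteq> (Neg v \<in> I))}"

text \<open>Satisfaction is only used for interpretations over a set containing the variables of the
  formula, where the absence of \<open>Pos v\<close> is the presence of \<open>Neg v\<close>.\<close>

primrec sat :: "'v literal set \<Rightarrow> 'v formula \<Rightarrow> bool" where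
  "sat I FTrue \<longleftrightarrow> True"
| "sat I FFalse \<longleftrightarrow> False"
| "sat I (FVar v) \<longleftrightarrow> Pos v \<in> I"
| "sat I (FNot \<phi>) \<longleftrightarrow> \<not> sat I \<phi>"
| "sat I (FAnd \<Phi>) \<longleftrightarrow> (\<forall>b\<in>#image_mset (sat I) \<Phi>. b)"
| "sat I (FOr \<Phi>) \<longleftrightarrow> (\<exists>b\<in>#image_mset (sat I) \<Phi>. b)"

definition theory_over :: "'v set \<Rightarrow> 'v formula set \<Rightarrow> bool" where
  "theory_over V T \<longleftrightarrow> (\<forall>\<phi>\<in>T. fvars \<phi> \<subseteq> V)"

definition models :: "'v set \<Rightarrow> 'v formula set \<Rightarrow> 'v literal set set" where
  "models V T = {I \<in> interpretations V. \<forall>\<phi>\<in>T. sat I \<phi>}"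

definition inconsistent :: "'v set \<Rightarrow> 'v formula \<Rightarrow> 'v formula \<Rightarrow> bool" where
  "inconsistent V \<phi> \<psi> \<longleftrightarrow> models V {\<phi>, \<psi>} = {}"

fun lit_formula :: "'v literal \<Rightarrow> 'v formula" where
  "lit_formula (Pos v) = FVar v"
| "lit_formula (Neg v) = FNot (FVar v)"

text \<open>The sort \<open>{comm_semiring_0, comm_monoid_mult}\<close> is that of commutative semirings with
  neutral elements \<open>0\<close> and \<open>1\<close>. Unlike \<open>comm_semiring_1\<close> it does not require
  \<open>0 \<noteq> 1\<close>.\<close>

definition amc ::
  "'v set \<Rightarrow> ('v literal \<Rightarrow> 'a::{comm_semiring_0, comm_monoid_mult}) \<Rightarrow> 'v formula set \<Rightarrow> 'a"
where
  "amc V \<alpha> T = (\<Sum>I\<in>models V T. \<Prod>l\<in>I. \<alpha> l)"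

datatype 'v label = LTrue | LFalse | LLit "'v literal" | LOr | LAnd

record ('n, 'v) circuit =
  nodes :: "'n set"
  arcs :: "('n \<times> 'n) set"
  root :: 'n
  label :: "'n \<Rightarrow> 'v label"

definition children :: "('n, 'v) circuit \<Rightarrow> 'n \<Rightarrow> 'n set" where
  "children C n = {m. (n, m) \<in> arcs C}"

locale nnf_circuit =
  fixes V :: "'v set" and C :: "('n, 'v) circuit"
  assumes finite_nodes: "finite (nodes C)"
    and arcs_nodes: "arcs C \<subseteq> nodes C \<times> nodes C"
    and acyclic_arcs: "acyclic (arcs C)"
    and root_node: "root C \<in> nodes C"
    and reachable: "n \<in> nodes C \<Longrightarrow> (root C, n) \<in> (arcs C)\<^sup>*"
    and internal_iff: "n \<in> nodes C \<Longrightarrow> children C n \<noteq> {} \<longleftrightarrow> label C n \<in> {LOr, LAnd}"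
    and literal_label: "n \<in> nodes C \<Longrightarrow> label C n = LLit l \<Longrightarrow> l \<in> literals V"
begin

lemma wf_arcs: "wf ((arcs C)\<inverse>)"
  using finite_nodes arcs_nodes acyclic_arcs
  by (meson finite_SigmaI finite_acyclic_wf_converse finite_subset)

lemma finite_children: "finite (children C n)"
  using finite_nodes arcs_nodes by (auto simp: children_def intro: finite_subset)

text \<open>The formula of the subcircuit rooted at a node. Distinct children with equal formulas are
  kept apart, since children are counted as a multiset.\<close>

function node_formula :: "'n \<Rightarrow> 'v formula" where
  "node_formula n =
    (case label C n of
       LTrue \<Rightarrow> FTrue
     | LFalse \<Rightarrow> FFalse
     | LLit l \<Rightarrow> lit_formula l
     | LOr \<Rightarrow> FOr (image_mset node_formula (mset_set (children C n)))
     | LAnd \<Rightarrow> FAnd (image_mset node_formula (mset_set (children C n))))"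
  by auto
termination
  by (relation "(arcs C)\<inverse>") (auto simp: wf_arcs finite_children, auto simp: children_def)

function node_eval ::
  "('v literal \<Rightarrow> 'a::{comm_semiring_0, comm_monoid_mult}) \<Rightarrow> 'n \<Rightarrow> 'a" where
  "node_eval \<alpha> n =
    (case label C n of
       LTrue \<Rightarrow> 1
     | LFalse \<Rightarrow> 0
     | LLit l \<Rightarrow> \<alpha> l
     | LOr \<Rightarrow> (\<Sum>m\<in>children C n. node_eval \<alpha> m)
     | LAnd \<Rightarrow> (\<Prod>m\<in>children C n. node_eval \<alpha> m))"
  by auto
termination
  by (relation "inv_image ((arcs C)\<inverse>) snd") (auto simp: wf_arcs children_def)

declare node_formula.simps [simp del] node_eval.simps [simp del]

definition circuit_formula :: "'v formula" where
  "circuit_formula = node_formula (root C)"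

definition eval :: "('v literal \<Rightarrow> 'a::{comm_semiring_0, comm_monoid_mult}) \<Rightarrow> 'a" where
  "eval \<alpha> = node_eval \<alpha> (root C)"

definition deterministic :: bool where
  "deterministic \<longleftrightarrow>
    (\<forall>n\<in>nodes C. label C n = LOr \<longrightarrow>
      (\<forall>m\<in>children C n. \<forall>k\<in>children C n. m \<noteq> k \<longrightarrow>
        inconsistent V (node_formula m) (node_formula k)))"

definition smooth :: bool where
  "smooth \<longleftrightarrow>
    (\<forall>n\<in>nodes C. label C n = LOr \<longrightarrow>
      (\<forall>m\<in>children C n. \<forall>k\<in>children C n. fvars (node_formula m) = fvars (node_formula k)))"

end

locale sd_nnf_representation = nnf_circuit V C
  for V :: "'v set" and T :: "'v formula set" and C :: "('n, 'v) circuit" +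
  assumes smooth: smooth
    and deterministic: deterministic
    and equivalent: "models V {circuit_formula} = models V T"
    and all_variables: "fvars circuit_formula = V"

end

(* For a node n with variables W, the value of n is the algebraic model count over W of the formula
   of n; at the root W is the whole of V. Disjunctions: smoothness makes W the same for all
   children, and determinism makes their sets of models disjoint. Conjunctions: distributivity
   turns the product of counts into a sum over tuples of models of the children; a clashing tuple
   contributes 0 since labels preserve consistency, and the product over a compatible one is the
   product over its union since multiplication is idempotent. This replaces decomposability. *)
theory Submission
  imports Defs
begin

section \<open>Interpretations and models under change of the variable set\<close>

lemma Pos_in_literals [simp]: "Pos v \<in> literals V \<longleftrightarrow> v \<in> V"
  and Neg_in_literals [simp]: "Neg v \<in> literals V \<longleftrightarrow> v \<in> V"
  by (auto simp: literals_def)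

lemma literals_Un: "literals (V \<union> W) = literals V \<union> literals W"
  by (auto simp: literals_def)

lemma finite_literals: "finite V \<Longrightarrow> finite (literals V)"
  by (simp add: literals_def)

lemma finite_interpretations: "finite V \<Longrightarrow> finite (interpretations V)"
  by (rule finite_subset[of _ "Pow (literals V)"]) (auto simp: interpretations_def finite_literals)

lemma finite_interpretation: "finite V \<Longrightarrow> I \<in> interpretations V \<Longrightarrow> finite I"
  by (auto simp: interpretations_def intro: finite_subset finite_literals)

lemma finite_models: "finite V \<Longrightarrow> finite (models V T)"
  by (simp add: models_def finite_interpretations)

lemma interpretations_restrict:
  assumes "I \<in> interpretations V" "W \<subseteq> V"
  shows "I \<inter> literals W \<in> interpretations W"
  using assms by (auto simp: interpretations_def)

text \<open>Some value must be chosen for the variables outside \<open>W\<close>; here all of them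
  become true.\<close>

lemma interpretations_extend:
  assumes "I \<in> interpretations W" "W \<subseteq> V"
  shows "I \<union> Pos ` (V - W) \<in> interpretations V"
  using assms by (auto simp: interpretations_def subset_iff image_iff literals_def)

text \<open>\<open>sat\<close> inspects only literals \<open>Pos v\<close> for variables
  \<open>v\<close> of the formula, and intersecting with \<open>literals W\<close> keeps
  these.\<close>

lemma sat_restrict: "fvars \<phi> \<subseteq> W \<Longrightarrow> sat (I \<inter> literals W) \<phi> \<longleftrightarrow> sat I \<phi>"
proof (induction \<phi>)
  case (FAnd \<Phi>)
  then have "sat (I \<inter> literals W) \<phi> \<longleftrightarrow> sat I \<phi>" if "\<phi> \<in># \<Phi>" for \<phi>
    using that by (simp add: UN_subset_iff)
  then show ?case by simp
next
  case (FOr \<Phi>)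
  then have "sat (I \<inter> literals W) \<phi> \<longleftrightarrow> sat I \<phi>" if "\<phi> \<in># \<Phi>" for \<phi>
    using that by (simp add: UN_subset_iff)
  then show ?case by simp
qed auto

lemma models_restrict:
  assumes "I \<in> models V T" "W \<subseteq> V" "theory_over W T"
  shows "I \<inter> literals W \<in> models W T"
  using assms by (auto simp: models_def theory_over_def interpretations_restrict sat_restrict)

lemma models_extend:
  assumes "I \<in> models W T" "W \<subseteq> V" "theory_over W T"
  shows "I \<union> Pos ` (V - W) \<in> models V T"
proof -
  have I: "I \<in> interpretations W" using assms by (simp add: models_def)
  then have "(I \<union> Pos ` (V - W)) \<inter> literals W = I"
    by (auto simp: interpretations_def)
  then have "sat (I \<union> Pos ` (V - W)) \<phi>" if "\<phi> \<in> T" for \<phi>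
    using assms that sat_restrict[of \<phi> W "I \<union> Pos ` (V - W)"]
    by (simp add: models_def theory_over_def)
  with I assms(2) show ?thesis by (simp add: models_def interpretations_extend)
qed

text \<open>Determinism speaks of models over all of \<open>V\<close>, while the count at a node
  ranges over the variables of that node. A common model over \<open>W\<close> would extend to one
  over \<open>V\<close>.\<close>

lemma inconsistent_restrict:
  assumes "inconsistent V \<phi> \<psi>" "fvars \<phi> \<subseteq> W" "fvars \<psi> \<subseteq> W" "W \<subseteq> V"
  shows "inconsistent W \<phi> \<psi>"
  using assms models_extend[of _ W "{\<phi>, \<psi>}" V]
  by (auto simp: inconsistent_def theory_over_def)

lemma interpretations_Un:
  assumes "I \<in> interpretations V" "J \<in> interpretations W"
    and "\<And>v. \<not> (Pos v \<in> I \<and> Neg v \<in> J)" "\<And>v. \<not> (Neg v \<in> I \<and> Pos v \<in> J)"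
  shows "I \<union> J \<in> interpretations (V \<union> W)"
  using assms unfolding interpretations_def literals_Un by blast

text \<open>\<open>I\<close> already decides every variable of \<open>V\<close>, so a further
  literal of \<open>V\<close> in \<open>K\<close> would clash with its complement in
  \<open>I\<close>. Hence a compatible pair of interpretations can be recovered from its
  union.\<close>

lemma interpretation_Int_literals:
  assumes "I \<in> interpretations V" "I \<subseteq> K" "K \<in> interpretations (V \<union> W)"
  shows "K \<inter> literals V = I"
proof
  show "K \<inter> literals V \<subseteq> I"
  proof
    fix l assume "l \<in> K \<inter> literals V"
    with assms show "l \<in> I" by (cases l) (auto simp: interpretations_def)
  qed
  show "I \<subseteq> K \<inter> literals V" using assms by (auto simp: interpretations_def)
qed

section \<open>Products of labels and the count of a binary conjunction\<close>

lemma prod_Un_idempotent: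
  fixes f :: "'b \<Rightarrow> 'a::comm_monoid_mult"
  assumes "\<And>a::'a. a * a = a" "finite A" "finite B"
  shows "prod f A * prod f B = prod f (A \<union> B)"
proof -
  \<comment> \<open>The product over the union has the product over the intersection as a factor, so
    multiplying by the latter once more is absorbed. By \<open>prod.union_inter\<close> that extra
    factor is exactly what separates the two sides.\<close>
  have "prod f (A \<union> B) = prod f ((A \<union> B) - (A \<inter> B)) * prod f (A \<inter> B)"
    using assms(2,3) by (intro prod.subset_diff) auto
  then have "prod f (A \<union> B) * prod f (A \<inter> B) = prod f (A \<union> B)"
    by (simp add: mult.assoc assms(1))
  then show ?thesis using prod.union_inter[OF assms(2,3), of f] by simp
qed

lemma prod_clash_eq_0:
  fixes f :: "'b \<Rightarrow> 'a::{comm_semiring_0, comm_monoid_mult}"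
  assumes "finite A" "finite B" "a \<in> A" "b \<in> B" "f a * f b = 0"
  shows "prod f A * prod f B = 0"
proof -
  have "prod f A * prod f B = f a * f b * (prod f (A - {a}) * prod f (B - {b}))"
    using prod.remove[OF assms(1,3), of f] prod.remove[OF assms(2,4), of f] by (simp add: ac_simps)
  then show ?thesis by (simp add: assms(5))
qed

text \<open>\<open>V\<close> and \<open>W\<close> may overlap: pairs that disagree on a shared
  variable vanish, and labels of shared literals are absorbed by idempotence.\<close>

lemma amc_mult:
  fixes \<alpha> :: "'v literal \<Rightarrow> 'a::{comm_semiring_0, comm_monoid_mult}"
  assumes idem: "\<And>a::'a. a * a = a"
    and cons: "\<And>v. v \<in> V \<Longrightarrow> \<alpha> (Pos v) * \<alpha> (Neg v) = 0"
    and fin: "finite V" "finite W"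
    and over: "theory_over V S" "theory_over W T"
  shows "amc V \<alpha> S * amc W \<alpha> T = amc (V \<union> W) \<alpha> (S \<union> T)"
proof -
  let ?P = "\<lambda>(I, J). prod \<alpha> I * prod \<alpha> J"
  let ?Q = "{(I, J) \<in> models V S \<times> models W T. I \<union> J \<in> interpretations (V \<union> W)}"
  have finM: "finite I" if "I \<in> models V S \<or> I \<in> models W T" for I
    using that fin finite_interpretation by (auto simp: models_def)
  have "amc V \<alpha> S * amc W \<alpha> T = sum ?P (models V S \<times> models W T)"
    by (simp add: amc_def sum_product sum.cartesian_product)
  also have "\<dots> = sum ?P ?Q"
  proof (rule sum.mono_neutral_right)
    show "\<forall>p\<in>models V S \<times> models W T - ?Q. ?P p = 0"
    proof
      fix p assume "p \<in> models V S \<times> models W T - ?Q"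
      then obtain I J where p: "p = (I, J)" and I: "I \<in> models V S" and J: "J \<in> models W T"
        and "I \<union> J \<notin> interpretations (V \<union> W)" by auto
      then obtain v where v: "Pos v \<in> I \<and> Neg v \<in> J \<or> Neg v \<in> I \<and> Pos v \<in> J"
        using interpretations_Un[of I V J W] by (auto simp: models_def)
      \<comment> \<open>\<open>cons\<close> covers only variables of \<open>V\<close>. One of the
        two clashing literals lies in \<open>I\<close>, an interpretation over
        \<open>V\<close>.\<close>
      moreover have "v \<in> V"
        using v I by (auto simp: models_def interpretations_def)
      ultimately show "?P p = 0"
        using prod_clash_eq_0[of I J "Pos v" "Neg v" \<alpha>] prod_clash_eq_0[of I J "Neg v" "Pos v" \<alpha>]
          finM p I J cons[of v] by (auto simp: mult.commute)
    qed
  qed (auto simp: finite_models fin)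
  also have "\<dots> = (\<Sum>K\<in>models (V \<union> W) (S \<union> T). prod \<alpha> K)"
  \<comment> \<open>Union and restriction to the two sets of literals are mutually inverse between
    compatible pairs of models and models of the joint theory.\<close>
  proof (rule sum.reindex_bij_witness[where i = "\<lambda>K. (K \<inter> literals V, K \<inter> literals W)"
        and j = "\<lambda>(I, J). I \<union> J"])
    fix p assume "p \<in> ?Q"
    then obtain I J where p: "p = (I, J)" and I: "I \<in> models V S" and J: "J \<in> models W T"
      and K: "I \<union> J \<in> interpretations (V \<union> W)" by auto
    have eqI: "(I \<union> J) \<inter> literals V = I"
      using I K by (intro interpretation_Int_literals[of _ _ _ W]) (auto simp: models_def)
    have eqJ: "(I \<union> J) \<inter> literals W = J"
      using J K by (intro interpretation_Int_literals[of _ _ _ V]) (auto simp: models_def Un_commute)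
    show "(\<lambda>K. (K \<inter> literals V, K \<inter> literals W)) ((\<lambda>(I, J). I \<union> J) p) = p"
      using p eqI eqJ by simp
    have "sat (I \<union> J) \<phi>" if "\<phi> \<in> S \<union> T" for \<phi>
      using that over I J sat_restrict[of \<phi> V "I \<union> J"] sat_restrict[of \<phi> W "I \<union> J"]
      unfolding eqI eqJ by (auto simp: models_def theory_over_def)
    with p K show "(\<lambda>(I, J). I \<union> J) p \<in> models (V \<union> W) (S \<union> T)"
      by (simp add: models_def)
    show "prod \<alpha> ((\<lambda>(I, J). I \<union> J) p) = ?P p"
      using p I J by (simp add: prod_Un_idempotent[OF idem] finM)
  next
    fix K assume K: "K \<in> models (V \<union> W) (S \<union> T)"
    then have "K \<subseteq> literals V \<union> literals W"
      by (simp add: models_def interpretations_def literals_Un)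
    then have eq: "K \<inter> literals V \<union> K \<inter> literals W = K" by auto
    then show "(\<lambda>(I, J). I \<union> J) (K \<inter> literals V, K \<inter> literals W) = K" by simp
    have "K \<in> models (V \<union> W) S" "K \<in> models (V \<union> W) T"
      using K by (auto simp: models_def)
    then have "K \<inter> literals V \<in> models V S" "K \<inter> literals W \<in> models W T"
      using over by (auto intro: models_restrict)
    then show "(K \<inter> literals V, K \<inter> literals W) \<in> ?Q"
      using K eq by (simp add: models_def)
  qed
  finally show ?thesis by (simp add: amc_def)
qed

section \<open>Counts of finite conjunctions, disjunctions and literals\<close>

lemma amc_empty: "amc {} \<alpha> {} = 1"
  by (simp add: amc_def models_def interpretations_def literals_def)

text \<open>Iterates \<open>amc_mult\<close>, starting from \<open>amc_empty\<close>. Indices with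
  equal formulas merge in the image of \<open>M\<close>; this is harmless since
  \<open>amc_mult\<close> allows the two theories to overlap. The common bound \<open>V\<close>
  supplies finiteness and the consistency of labels.\<close>

lemma amc_prod:
  fixes \<alpha> :: "'v literal \<Rightarrow> 'a::{comm_semiring_0, comm_monoid_mult}"
  assumes idem: "\<And>a::'a. a * a = a"
    and cons: "\<And>v. v \<in> V \<Longrightarrow> \<alpha> (Pos v) * \<alpha> (Neg v) = 0"
    and "finite V" "finite M" "\<And>m. m \<in> M \<Longrightarrow> fvars (f m) \<subseteq> V"
  shows "(\<Prod>m\<in>M. amc (fvars (f m)) \<alpha> {f m}) = amc (\<Union>m\<in>M. fvars (f m)) \<alpha> (f ` M)"
  using assms(4,5)
proof (induction M)
  case empty
  then show ?case by (simp add: amc_empty)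
next
  case (insert m M)
  have "amc (fvars (f m)) \<alpha> {f m} * amc (\<Union>k\<in>M. fvars (f k)) \<alpha> (f ` M) =
      amc (fvars (f m) \<union> (\<Union>k\<in>M. fvars (f k))) \<alpha> ({f m} \<union> f ` M)"
    using insert.prems insert.hyps \<open>finite V\<close>
    by (intro amc_mult idem cons) (auto simp: theory_over_def intro: finite_subset)
  with insert show ?case by simp
qed

lemma models_FAnd:
  assumes "finite M"
  shows "models V {FAnd (image_mset f (mset_set M))} = models V (f ` M)"
  using assms by (auto simp: models_def)

lemma models_FOr:
  assumes "finite M"
  shows "models V {FOr (image_mset f (mset_set M))} = (\<Union>m\<in>M. models V {f m})"
  using assms by (auto simp: models_def)

text \<open>Inconsistency makes the sets of models disjoint, so the sum over their union splits.
  Distinct indices with equal formulas fit in: such a formula is inconsistent with itself and has no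
  models.\<close>

lemma amc_sum:
  assumes "finite V" "finite M"
    and "\<And>m k. m \<in> M \<Longrightarrow> k \<in> M \<Longrightarrow> m \<noteq> k \<Longrightarrow> inconsistent V (f m) (f k)"
  shows "(\<Sum>m\<in>M. amc V \<alpha> {f m}) = amc V \<alpha> {FOr (image_mset f (mset_set M))}"
proof -
  have "models V {f m} \<inter> models V {f k} = {}" if "m \<in> M" "k \<in> M" "m \<noteq> k" for m k
    using assms(3)[OF that] by (auto simp: inconsistent_def models_def)
  then show ?thesis
    by (simp add: amc_def models_FOr assms(1,2) sum.UNION_disjoint finite_models)
qed

lemma interpretations_singleton: "interpretations {v} = {{Pos v}, {Neg v}}"
  by (auto simp: interpretations_def literals_def)

lemma amc_lit_formula: "amc (fvars (lit_formula l)) \<alpha> {lit_formula l} = \<alpha> l"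
proof -
  have "models (fvars (lit_formula l)) {lit_formula l} = {{l}}"
    by (cases l) (auto simp: models_def interpretations_singleton)
  then show ?thesis by (simp add: amc_def)
qed

section \<open>Variables and values of circuit nodes\<close>

context nnf_circuit
begin

lemma children_nodes: "m \<in> children C n \<Longrightarrow> m \<in> nodes C"
  using arcs_nodes by (auto simp: children_def)

lemma fvars_node_formula:
  assumes "n \<in> nodes C"
  shows "fvars (node_formula n) \<subseteq> V"
  using wf_arcs assms
proof (induction n)
  case (less n)
  then have IH: "fvars (node_formula m) \<subseteq> V" if "m \<in> children C n" for m
    using that children_nodes by (auto simp: children_def)
  show ?case
  proof (cases "label C n")
    case (LLit l)
    with literal_label[OF less.prems LLit] show ?thesis
      by (cases l) (auto simp: node_formula.simps[of n])
  qed (use IH in \<open>auto simp: node_formula.simps[of n] finite_children\<close>)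
qed

text \<open>Induction along the converse of \<open>arcs C\<close>, from the leaves upwards. Counting
  over the variables of each node, instead of over \<open>V\<close>, is what makes the statement
  hold at every node.\<close>

lemma node_eval_eq_amc:
  fixes \<alpha> :: "'v literal \<Rightarrow> 'a::{comm_semiring_0, comm_monoid_mult}"
  assumes idem: "\<And>a::'a. a * a = a"
    and cons: "\<And>v. v \<in> V \<Longrightarrow> \<alpha> (Pos v) * \<alpha> (Neg v) = 0"
    and fin: "finite V" and smooth and deterministic
    and "n \<in> nodes C"
  shows "node_eval \<alpha> n = amc (fvars (node_formula n)) \<alpha> {node_formula n}"
  using wf_arcs assms(6)
proof (induction n)
  case (less n)
  let ?M = "children C n" and ?W = "fvars (node_formula n)"
  have IH: "node_eval \<alpha> m = amc (fvars (node_formula m)) \<alpha> {node_formula m}" if "m \<in> ?M" for m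
    using less that children_nodes by (auto simp: children_def)
  have sub: "fvars (node_formula m) \<subseteq> V" if "m \<in> ?M" for m
    using that children_nodes fvars_node_formula by blast
  have WV: "?W \<subseteq> V" using less.prems by (rule fvars_node_formula)
  show ?case
  proof (cases "label C n")
    case LTrue
    \<comment> \<open>\<open>FTrue\<close> has no variables and excludes no interpretation, so
      \<open>amc_empty\<close> gives its count.\<close>
    have "models {} {FTrue :: 'v formula} = models {} {}" by (simp add: models_def)
    with LTrue show ?thesis using amc_empty[of \<alpha>]
      by (simp add: node_eval.simps[of _ n] node_formula.simps[of n] amc_def)
  next
    case LFalse
    then show ?thesis
      by (simp add: node_eval.simps[of _ n] node_formula.simps[of n] amc_def models_def)
  next
    case (LLit l)
    then show ?thesis
      by (simp add: node_eval.simps[of _ n] node_formula.simps[of n] amc_lit_formula)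
  next
    case LOr
    have form: "node_formula n = FOr (image_mset node_formula (mset_set ?M))"
      by (simp add: node_formula.simps[of n] LOr)
    have "fvars (node_formula m) = fvars (node_formula k)" if "m \<in> ?M" "k \<in> ?M" for m k
      using \<open>smooth\<close> less.prems LOr that unfolding smooth_def by blast
    moreover have "?W = (\<Union>k\<in>?M. fvars (node_formula k))"
      by (simp add: form finite_children)
    \<comment> \<open>The variables of the disjunction are the union of sets that smoothness makes
      equal, so each child is counted over \<open>?W\<close> itself.\<close>
    ultimately have W: "fvars (node_formula m) = ?W" if "m \<in> ?M" for m
      using that by blast
    have inc: "inconsistent ?W (node_formula m) (node_formula k)"
      if "m \<in> ?M" "k \<in> ?M" "m \<noteq> k" for m k
    proof (rule inconsistent_restrict[OF _ _ _ WV])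
      show "inconsistent V (node_formula m) (node_formula k)"
        using \<open>deterministic\<close> less.prems LOr that unfolding deterministic_def by blast
    qed (use W that in blast)+
    have "node_eval \<alpha> n = (\<Sum>m\<in>?M. node_eval \<alpha> m)"
      by (simp add: node_eval.simps[of _ n] LOr)
    also have "\<dots> = (\<Sum>m\<in>?M. amc ?W \<alpha> {node_formula m})"
      using IH W by (intro sum.cong) auto
    also have "\<dots> = amc ?W \<alpha> {FOr (image_mset node_formula (mset_set ?M))}"
      by (rule amc_sum[OF finite_subset[OF WV fin] finite_children inc])
    also have "\<dots> = amc ?W \<alpha> {node_formula n}"
      by (simp only: form)
    finally show ?thesis .
  next
    case LAnd
    have form: "node_formula n = FAnd (image_mset node_formula (mset_set ?M))"
      by (simp add: node_formula.simps[of n] LAnd)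
    have "node_eval \<alpha> n = (\<Prod>m\<in>?M. node_eval \<alpha> m)"
      by (simp add: node_eval.simps[of _ n] LAnd)
    also have "\<dots> = (\<Prod>m\<in>?M. amc (fvars (node_formula m)) \<alpha> {node_formula m})"
      using IH by (intro prod.cong) auto
    also have "\<dots> = amc (\<Union>m\<in>?M. fvars (node_formula m)) \<alpha> (node_formula ` ?M)"
      by (intro amc_prod[where V = V] idem cons fin finite_children sub)
    also have "\<dots> = amc ?W \<alpha> {node_formula n}"
      by (simp add: form amc_def models_FAnd finite_children)
    finally show ?thesis .
  qed
qed

end

theorem theorem6:
  fixes V :: "'v set" and T :: "'v formula set"
    and \<alpha> :: "'v literal \<Rightarrow> 'a::{comm_semiring_0, comm_monoid_mult}"
    and N\<^sub>T :: "('n, 'v) circuit"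
  assumes "finite V"
    and "theory_over V T"
    and idempotent: "\<And>a::'a. a * a = a"
    and consistency_preserving: "\<And>v. v \<in> V \<Longrightarrow> \<alpha> (Pos v) * \<alpha> (Neg v) = 0"
    and "sd_nnf_representation V T N\<^sub>T"
  shows "nnf_circuit.eval N\<^sub>T \<alpha> = amc V \<alpha> T"
proof -
  interpret sd_nnf_representation V T N\<^sub>T by fact
  have "eval \<alpha> = amc (fvars circuit_formula) \<alpha> {circuit_formula}"
    unfolding eval_def circuit_formula_def
    by (intro node_eval_eq_amc idempotent consistency_preserving assms(1) smooth deterministic
        root_node)
  \<comment> \<open>At the root the variables are all of \<open>V\<close>, and equivalence replaces
    the models of the circuit by those of \<open>T\<close>.\<close>
  then show ?thesis by (simp add: all_variables amc_def equivalent)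
qed

end
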